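(* Let $m\ge 2$ and $n\ge 1$ be integers. The diameter of the transition graph $G(R_{m,n})$ of the robot of length $n$ in a tunnel of width $m$ is $$\operatorname{diam} G(R_{m,n})=\begin{cases} d(L_{m,n},H_{m,n}) & \text{for } n<6,\\ d(L_{m,n},L_{m,n}^+) & \text{for } n\ge 6,\end{cases}$$ where $d$ is the graph distance in $G(R_{m,n})$. These distances are explicitly given by $$d(L_{m,n},H_{m,n})=s_n-z_{m,n},\qquad d(L_{m,n},L_{m,n}^+)=s_{n-1}-z_{m,n}+s_{n-2}-z_{m,m+n-3},$$ where $s_n=\binom{n+1}{2}$ and $z_{m,n}=(r+1)k+\binom{k}{2}(m+1)$ with $n=(m+1)k+r$, $0\le r\le m$.
   Context: **Positions.** A position of the robotic arm $R_{m,n}$ is a lattice path of $n$ unit links starting at $(0,0)$, each link facing up ($u$), down ($d$) or right ($r$), staying in the strip $0\le y\le m$ and not intersecting itself; equivalently a word in $\{u,d,r\}^n$ with no two consecutive letters $ud$ or $du$ and all heights in $[0,m]$. **Moves and transition graph.** (Switch corners) two consecutive links facing different directions (one vertical, one horizontal) interchange directions; (flip the end) the last link rotates by $90^\circ$ ($r\leftrightarrow u$ or $r\leftrightarrow d$). A move is legal only if its result is a position. The transition graph $G(R_{m,n})$ has the positions as vertices and the legal moves as edges; its diameter is the largest graph distance between two vertices. **Special positions.** $L_{m,n}$ (left justified) is the position given by the first $n$ letters of $u^m r d^m r u^m r d^m r\cdots$; $L_{m,n}^+$ (shifted left justified) is given by the first $n$ letters of $(urdr)(u^m r d^m r u^m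 r\cdots)$; $H_{m,n}=rr\cdots r$ is the fully horizontal position. *)

theory Defs
  imports "Graph_Theory.Pair_Digraph" "Graph_Theory.Shortest_Path" "HOL-Library.Stream"
begin

section \<open>Positions of the robotic arm\<close>

datatype link = U | D | R

fun move_along :: "link \<Rightarrow> int \<times> int \<Rightarrow> int \<times> int" where
  "move_along U (x, y) = (x, y + 1)"
| "move_along D (x, y) = (x, y - 1)"
| "move_along R (x, y) = (x + 1, y)"

fun joints :: "int \<times> int \<Rightarrow> link list \<Rightarrow> (int \<times> int) list" where
  "joints p [] = [p]"
| "joints p (l # w) = p # joints (move_along l p) w"

text \<open>
  Since the links are unit steps between lattice points, the path stays in the strip iff its
  lattice points do, and it is free of self-intersections iff its lattice points are distinct.
  The lemma \<open>positions_altdef\<close> below gives the description by forbidden subwords.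
\<close>

definition positions :: "nat \<Rightarrow> nat \<Rightarrow> link list set" where
  "positions m n =
     {w. length w = n \<and> distinct (joints (0, 0) w) \<and>
         (\<forall>(x, y) \<in> set (joints (0, 0) w). 0 \<le> y \<and> y \<le> int m)}"

section \<open>Moves and the transition graph\<close>

definition perpendicular :: "link \<Rightarrow> link \<Rightarrow> bool" where
  "perpendicular a b \<longleftrightarrow> (a = R) \<noteq> (b = R)"

definition switch_corners :: "link list \<Rightarrow> link list \<Rightarrow> bool" where
  "switch_corners v w \<longleftrightarrow>
     (\<exists>xs a b ys. perpendicular a b \<and> v = xs @ [a, b] @ ys \<and> w = xs @ [b, a] @ ys)"

definition flip_end :: "link list \<Rightarrow> link list \<Rightarrow> bool" where
  "flip_end v w \<longleftrightarrow> (\<exists>xs a b. perpendicular a b \<and> v = xs @ [a] \<and> w = xs @ [b])"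

text \<open>The undirected edge \<open>{v, w}\<close> is represented by the two arcs \<open>(v, w)\<close> and \<open>(w, v)\<close>.\<close>

definition transition_graph :: "nat \<Rightarrow> nat \<Rightarrow> link list pair_pre_digraph" where
  "transition_graph m n =
     \<lparr> pverts = positions m n,
       parcs = {(v, w). v \<in> positions m n \<and> w \<in> positions m n \<and>
                        (switch_corners v w \<or> flip_end v w)} \<rparr>"

text \<open>
  The number of arcs of a shortest walk, that is, the shortest-path cost for unit weights; it is
  \<open>\<infinity>\<close> if there is no walk (in particular if an endpoint is not a vertex).
\<close>

definition graph_dist :: "'a pair_pre_digraph \<Rightarrow> 'a \<Rightarrow> 'a \<Rightarrow> ereal" where
  "graph_dist G v w = wf_digraph.\<mu> (with_proj G) (\<lambda>_. 1) v w"

definition graph_diameter :: "'a pair_pre_digraph \<Rightarrow> ereal" where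
  "graph_diameter G = (SUP v \<in> pverts G. SUP w \<in> pverts G. graph_dist G v w)"

section \<open>Special positions\<close>

definition snake :: "nat \<Rightarrow> link stream" where
  "snake m = cycle (replicate m U @ [R] @ replicate m D @ [R])"

definition left_justified :: "nat \<Rightarrow> nat \<Rightarrow> link list" where
  "left_justified m n = stake n (snake m)"

definition shifted_left_justified :: "nat \<Rightarrow> nat \<Rightarrow> link list" where
  "shifted_left_justified m n = stake n ([U, R, D, R] @- snake m)"

definition horizontal :: "nat \<Rightarrow> link list" where
  "horizontal n = replicate n R"

section \<open>The explicit formulas\<close>

text \<open>
  The truncated subtraction on \<open>nat\<close> is harmless in \<open>s_num (n - 2)\<close> for \<open>n = 1\<close>, because
  the binomial coefficient \<open>0 choose 2\<close> for \<open>n - 2 = -1\<close> is \<open>0 = s_num 0\<close>.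
\<close>

definition s_num :: "nat \<Rightarrow> nat" where
  "s_num n = (n + 1) choose 2"

definition z_num :: "nat \<Rightarrow> nat \<Rightarrow> nat" where
  "z_num m n = (let k = n div (m + 1); r = n mod (m + 1) in (r + 1) * k + (k choose 2) * (m + 1))"

section \<open>Consistency of the definitions\<close>

definition no_reversal :: "link list \<Rightarrow> bool" where
  "no_reversal = successively (\<lambda>a b. \<not> (a = U \<and> b = D) \<and> \<not> (a = D \<and> b = U))"

lemma fst_joints: "q \<in> set (joints p w) \<Longrightarrow> fst p \<le> fst q"
proof (induction w arbitrary: p)
  case (Cons l w)
  have "fst p \<le> fst (move_along l p)" by (cases p; cases l) auto
  with Cons show ?case by fastforce
qed auto

lemma joints_beyond_U:
  assumes "no_reversal (U # w)" "q \<in> set (joints (x, y) w)"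
  shows "x < fst q \<or> y \<le> snd q"
  using assms
proof (induction w arbitrary: y)
  case (Cons l w)
  then show ?case
    using fst_joints[of q "(x + 1, y)" w]
    by (cases l; force simp: no_reversal_def)
qed auto

lemma joints_beyond_D:
  assumes "no_reversal (D # w)" "q \<in> set (joints (x, y) w)"
  shows "x < fst q \<or> snd q \<le> y"
  using assms
proof (induction w arbitrary: y)
  case (Cons l w)
  then show ?case
    using fst_joints[of q "(x + 1, y)" w]
    by (cases l; force simp: no_reversal_def)
qed auto

lemma distinct_joints_iff: "distinct (joints p w) \<longleftrightarrow> no_reversal w"
proof (induction w arbitrary: p)
  case Nil
  then show ?case by (simp add: no_reversal_def)
next
  case (Cons l w)
  obtain x y where p: "p = (x, y)" by fastforce
  have "p \<notin> set (joints (move_along l p) w)" if "no_reversal (l # w)"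
  proof
    assume *: "p \<in> set (joints (move_along l p) w)"
    show False
      using that * joints_beyond_U[of w p x "y + 1"] joints_beyond_D[of w p x "y - 1"]
        fst_joints[of p "(x + 1, y)" w]
      by (cases l) (auto simp: p)
  qed
  moreover have "no_reversal (l # w)"
    if "p \<notin> set (joints (move_along l p) w)" "no_reversal w"
    using that
  proof (cases w)
    case (Cons l' w')
    have "p \<in> set (joints p w')" by (cases w') auto
    then show ?thesis using that Cons
      by (cases l; cases l') (auto simp: no_reversal_def p)
  qed (simp add: no_reversal_def)
  moreover have "no_reversal w" if "no_reversal (l # w)"
    using that by (cases w) (auto simp: no_reversal_def)
  ultimately show ?case using Cons.IH by auto
qed

lemma positions_altdef:
  "positions m n =
     {w. length w = n \<and> no_reversal w \<and>
         (\<forall>(x, y) \<in> set (joints (0, 0) w). 0 \<le> y \<and> y \<le> int m)}"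
  by (simp add: positions_def distinct_joints_iff)

lemma finite_positions: "finite (positions m n)"
proof (rule finite_subset)
  have "(UNIV :: link set) = {U, D, R}" using link.exhaust by auto
  then have "finite (UNIV :: link set)" by (metis finite.simps)
  then show "finite {w :: link list. set w \<subseteq> UNIV \<and> length w = n}"
    by (rule finite_lists_length_eq)
  show "positions m n \<subseteq> {w. set w \<subseteq> UNIV \<and> length w = n}"
    by (auto simp: positions_def)
qed

lemma pair_graph_transition_graph: "pair_graph (transition_graph m n)"
proof
  show "symmetric (with_proj (transition_graph m n))"
    unfolding symmetric_def arcs_ends_def
    by (auto simp: transition_graph_def arc_to_ends_def sym_def image_iff
        switch_corners_def flip_end_def perpendicular_def; metis)
qed (auto simp: transition_graph_def finite_positions switch_corners_def flip_end_def
       perpendicular_def intro: finite_subset[OF _ finite_cartesian_product[OF finite_positions finite_positions]])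

end

theory Submission
  imports Defs
begin

text \<open>
  The weight of a word, the sum of \<open>n + 1 - i\<close> over its vertical links at positions
  \<open>i = 1, \<dots>, n\<close>, changes by exactly one under every move, and a word can be turned into
  \<open>H\<close> by moves that all lower the weight, last vertical link first; so it is the distance to
  \<open>H\<close>. A position has a horizontal link in each block of \<open>m + 1\<close> consecutive links, and
  \<open>L\<close> has as few of them, and as late, as this allows: it has the maximal weight
  \<open>a n\<close> (\<open>maxw m n\<close> below).

  For two arbitrary positions only the first two vertical links matter. The first one goes up in
  both. If the second ones do not conflict, move the first two links of one position onto those of
  the other and clear and rebuild everything behind them; if one goes up and the other down, do
  this with the first link only. Both walks have length at most
  \<open>a n + max 0 (a (n - 4) - 2)\<close>. For \<open>n < 6\<close> this is \<open>a n\<close>, the weight of \<open>L\<close>; for \<open>n \<ge> 6\<close>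
  it is the distance of \<open>L\<close> and \<open>L\<^sup>+\<close>, which is bounded below by the weight behind the first
  vertical link, signed by the direction of the second one: this changes by at most one
  under every move.
\<close>

section \<open>Positions as words\<close>

fun rise :: "link \<Rightarrow> int" where
  "rise U = 1" | "rise D = -1" | "rise R = 0"

fun strip :: "nat \<Rightarrow> int \<Rightarrow> link list \<Rightarrow> bool" where
  "strip m h [] \<longleftrightarrow> 0 \<le> h \<and> h \<le> int m"
| "strip m h (l # w) \<longleftrightarrow> 0 \<le> h \<and> h \<le> int m \<and> strip m (h + rise l) w"

lemma strip_append:
  "strip m h (xs @ ys) \<longleftrightarrow> strip m h xs \<and> strip m (h + sum_list (map rise xs)) ys"
proof (induction xs arbitrary: h)
  case Nil
  then show ?case by (cases ys) auto
qed (auto simp: add.assoc)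

lemma strip_replicate_R [simp]: "strip m h (replicate k R) \<longleftrightarrow> 0 \<le> h \<and> h \<le> int m"
  by (induction k) auto

lemma sum_list_replicate_0 [simp]: "sum_list (replicate k (0 :: int)) = 0"
  by (induction k) auto

lemma sum_list_rise_replicate: "sum_list (map rise (replicate k l)) = int k * rise l"
  by (induction k) (auto simp: algebra_simps)

lemma strip_bounds: "strip m h w \<Longrightarrow> 0 \<le> h \<and> h \<le> int m"
  by (cases w) auto

lemma joints_strip:
  "(\<forall>(x, y) \<in> set (joints (a, h) w). 0 \<le> y \<and> y \<le> int m) \<longleftrightarrow> strip m h w"
proof (induction w arbitrary: a h)
  case (Cons l w)
  then show ?case by (cases l) auto
qed auto

lemma in_positions_iff:
  "w \<in> positions m n \<longleftrightarrow> length w = n \<and> no_reversal w \<and> strip m 0 w"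
  by (simp add: positions_altdef joints_strip)

lemma no_reversal_simps [simp]:
  "no_reversal []" "no_reversal [l]" "no_reversal (R # w) \<longleftrightarrow> no_reversal w"
  "no_reversal (l # R # w) \<longleftrightarrow> no_reversal w"
  by (cases w; simp add: no_reversal_def)+

lemma no_reversal_ConsD: "no_reversal (l # w) \<Longrightarrow> no_reversal w"
  by (cases w) (auto simp: no_reversal_def)

lemma no_reversal_replicate [simp]: "no_reversal (replicate k R)"
  by (induction k) auto

lemma no_reversal_append:
  "no_reversal (xs @ ys) \<longleftrightarrow> no_reversal xs \<and> no_reversal ys \<and>
     (xs = [] \<or> ys = [] \<or> \<not> (last xs = U \<and> hd ys = D) \<and> \<not> (last xs = D \<and> hd ys = U))"
  by (auto simp: no_reversal_def successively_append_iff)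

lemma no_reversal_append_R [simp]:
  "no_reversal (xs @ R # ys) \<longleftrightarrow> no_reversal xs \<and> no_reversal ys"
  by (simp add: no_reversal_append)

lemma no_reversal_replicate_append [simp]:
  "no_reversal (replicate k R @ w) \<longleftrightarrow> no_reversal w"
  by (induction k) auto

lemma strip_replicate_append [simp]:
  "strip m h (replicate k R @ w) \<longleftrightarrow> strip m h w"
  using strip_bounds[of m h w] by (auto simp: strip_append)

section \<open>Moves\<close>

text \<open>Of two perpendicular links exactly one is horizontal, so every move or its inverse
  brings a vertical link one place forward or creates one at the end. This direction increases the
  weight; legality is left to \<open>positions\<close>.\<close>

inductive raise :: "link list \<Rightarrow> link list \<Rightarrow> bool" where
  swap: "a \<noteq> R \<Longrightarrow> raise (R # a # w) (a # R # w)"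
| flip: "a \<noteq> R \<Longrightarrow> raise [R] [a]"
| Cons: "raise v w \<Longrightarrow> raise (l # v) (l # w)"

lemma raise_prefix: "raise v w \<Longrightarrow> raise (xs @ v) (xs @ w)"
  by (induction xs) (auto intro: raise.intros)

lemma raise_length: "raise v w \<Longrightarrow> length v = length w"
  by (induction rule: raise.induct) auto

lemma raise_imp_move:
  "raise v w \<Longrightarrow> switch_corners v w \<or> flip_end v w"
proof (induction rule: raise.induct)
  case (swap a w)
  then show ?case
    unfolding switch_corners_def perpendicular_def
    by (intro disjI1 exI[of _ "[]"] exI[of _ R] exI[of _ a] exI[of _ w]) auto
next
  case (flip a)
  then show ?case
    unfolding flip_end_def perpendicular_def
    by (intro disjI2 exI[of _ "[]"] exI[of _ R] exI[of _ a]) auto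
next
  case (Cons v w l)
  then show ?case
    unfolding flip_end_def switch_corners_def by (metis append_Cons)
qed

lemma move_sym: "switch_corners v w \<or> flip_end v w \<Longrightarrow> switch_corners w v \<or> flip_end w v"
  unfolding flip_end_def switch_corners_def perpendicular_def by metis

lemma move_iff_raise: "switch_corners v w \<or> flip_end v w \<longleftrightarrow> raise v w \<or> raise w v"
proof
  assume "switch_corners v w \<or> flip_end v w"
  then show "raise v w \<or> raise w v"
  proof
    assume "switch_corners v w"
    then obtain xs a b ys where *: "perpendicular a b" "v = xs @ [a, b] @ ys" "w = xs @ [b, a] @ ys"
      by (auto simp: switch_corners_def)
    have "raise ([a, b] @ ys) ([b, a] @ ys) \<or> raise ([b, a] @ ys) ([a, b] @ ys)"
      using *(1) by (auto simp: perpendicular_def intro: raise.intros)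
    with * show ?thesis using raise_prefix by metis
  next
    assume "flip_end v w"
    then obtain xs a b where *: "perpendicular a b" "v = xs @ [a]" "w = xs @ [b]"
      by (auto simp: flip_end_def)
    have "raise [a] [b] \<or> raise [b] [a]"
      using *(1) by (auto simp: perpendicular_def intro: raise.intros)
    with * show ?thesis using raise_prefix by metis
  qed
qed (use raise_imp_move move_sym in blast)

abbreviation arcs_of :: "nat \<Rightarrow> nat \<Rightarrow> (link list \<times> link list) set" where
  "arcs_of m n \<equiv> parcs (transition_graph m n)"

lemma arcs_of_iff:
  "(v, w) \<in> arcs_of m n \<longleftrightarrow>
     v \<in> positions m n \<and> w \<in> positions m n \<and> (raise v w \<or> raise w v)"
  by (simp add: transition_graph_def move_iff_raise)

lemma arcs_of_sym: "(v, w) \<in> arcs_of m n \<longleftrightarrow> (w, v) \<in> arcs_of m n"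
  by (auto simp: arcs_of_iff)

section \<open>Bounds on the graph distance from walks and from Lipschitz functions\<close>

lemma relpow_sym:
  assumes "\<And>x y. (x, y) \<in> E \<Longrightarrow> (y, x) \<in> E" and "(x, y) \<in> E ^^ k"
  shows "(y, x) \<in> E ^^ k"
  using assms(2)
proof (induction k arbitrary: y)
  case (Suc k)
  then obtain z where "(x, z) \<in> E ^^ k" "(z, y) \<in> E" by auto
  with Suc.IH assms(1) show ?case by (metis relpow_Suc_I2)
qed auto

lemma arcs_relpow_sym: "(v, w) \<in> arcs_of m n ^^ k \<Longrightarrow> (w, v) \<in> arcs_of m n ^^ k"
  by (rule relpow_sym) (use arcs_of_sym in blast)+

text \<open>Relational powers record only the length, so walks are glued by
  \<open>relpow_trans\<close>. For \<open>k = 0\<close> no arc shows that \<open>u\<close> is a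
  vertex, hence the second assumption.\<close>

lemma (in pair_wf_digraph) relpow_imp_graph_dist_le:
  assumes "(u, v) \<in> parcs G ^^ k" "u \<in> pverts G"
  shows "graph_dist G u v \<le> ereal (real k)"
proof -
  have "\<exists>p. awalk u p v \<and> awalk_cost (\<lambda>_. 1) p = real k"
    using assms
  proof (induction k arbitrary: u)
    case 0
    then show ?case by (intro exI[of _ "[]"]) (auto simp: awalk_Nil_iff)
  next
    case (Suc k)
    from Suc.prems(1) obtain w where w: "(u, w) \<in> parcs G" "(w, v) \<in> parcs G ^^ k"
      by (metis relpow_Suc_D2)
    then have "w \<in> pverts G" by (auto dest: in_arcsD2)
    with Suc.IH w obtain p where "awalk w p v" "awalk_cost (\<lambda>_. 1) p = real k" by blast
    with w Suc.prems show ?case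
      by (intro exI[of _ "(u, w) # p"]) (auto simp: awalk_Cons_iff)
  qed
  then obtain p where "awalk u p v" "awalk_cost (\<lambda>_. 1) p = real k" by blast
  with min_cost_le_walk_cost[OF this(1), of "\<lambda>_. 1"] show ?thesis
    by (simp add: graph_dist_def)
qed

text \<open>The source of all lower bounds: along any walk \<open>f\<close> changes by at most one
  per arc.\<close>

lemma (in pair_wf_digraph) lipschitz_le_graph_dist:
  fixes f :: "'a \<Rightarrow> int"
  assumes "\<And>v w. (v, w) \<in> parcs G \<Longrightarrow> \<bar>f v - f w\<bar> \<le> 1"
  shows "ereal (of_int \<bar>f u - f v\<bar>) \<le> graph_dist G u v"
proof -
  have "of_int \<bar>f u - f v\<bar> \<le> awalk_cost (\<lambda>_. 1) p" if "awalk u p v" for p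
    using that
  proof (induction p arbitrary: u)
    case Nil
    then show ?case by (auto simp: awalk_Nil_iff)
  next
    case (Cons e p)
    obtain x y where e: "e = (x, y)" by fastforce
    with Cons.prems have "x = u" "(u, y) \<in> parcs G" "awalk y p v" by (auto simp: awalk_Cons_iff)
    then show ?case using Cons.IH[of y] assms[of u y] by (simp add: e)
  qed
  then show ?thesis
    by (auto simp: graph_dist_def \<mu>_def intro!: INF_greatest)
qed

lemma pair_wf_transition_graph: "pair_wf_digraph (transition_graph m n)"
  using pair_graph_transition_graph
  by (simp add: pair_graph_def pair_digraph_def pair_fin_digraph_def)

lemma pverts_transition_graph [simp]: "pverts (transition_graph m n) = positions m n"
  by (simp add: transition_graph_def)

section \<open>The weight of a word\<close>

fun weight :: "link list \<Rightarrow> nat" where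
  "weight [] = 0"
| "weight (l # w) = (if l = R then 0 else Suc (length w)) + weight w"

abbreviation verticals :: "link list \<Rightarrow> nat" where
  "verticals w \<equiv> length (filter (\<lambda>l. l \<noteq> R) w)"

lemma weight_append: "weight (xs @ ys) = weight xs + verticals xs * length ys + weight ys"
  by (induction xs) (auto simp: algebra_simps)

lemma weight_snoc: "weight (w @ [l]) = weight w + verticals (w @ [l])"
  by (simp add: weight_append)

lemma weight_replicate_R [simp]: "weight (replicate k R) = 0"
  by (induction k) auto

lemma raise_weight: "raise v w \<Longrightarrow> weight w = Suc (weight v)"
  by (induction rule: raise.induct) (auto dest: raise_length)

section \<open>The first vertical link and the signed weight\<close>

fun lead :: "link list \<Rightarrow> link" where
  "lead [] = R"
| "lead (l # w) = (if l = R then lead w else l)"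

fun after :: "link list \<Rightarrow> link list" where
  "after [] = []"
| "after (l # w) = (if l = R then after w else w)"

lemma lead_R_weight: "lead w = R \<Longrightarrow> weight w = 0"
  by (induction w) (auto split: if_splits)

lemma raise_lead: "raise v w \<Longrightarrow> lead v = R \<or> lead v = lead w"
  by (induction rule: raise.induct) auto

text \<open>The default \<open>R\<close> of \<open>lead\<close> gives sign 0 to words without
  vertical links. Their weight is 0 too, so the sign changes there without a jump.\<close>

definition signed_weight :: "link list \<Rightarrow> int" where
  "signed_weight w = rise (lead w) * int (weight w)"

lemma raise_signed_weight: "raise v w \<Longrightarrow> \<bar>signed_weight v - signed_weight w\<bar> \<le> 1"
  using raise_lead[of v w] raise_weight[of v w] lead_R_weight[of v]
  by (cases "lead w") (auto simp: signed_weight_def)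

text \<open>If the first vertical link itself moves, the word behind it changes only by a leading
  \<open>R\<close>, which leaves the signed weight alone; if it is created at the end, nothing is
  behind it. Any other move takes place behind it.\<close>

lemma raise_signed_weight_after:
  "raise v w \<Longrightarrow> \<bar>signed_weight (after v) - signed_weight (after w)\<bar> \<le> 1"
proof (induction rule: raise.induct)
  case (Cons v w l)
  then show ?case using raise_signed_weight by auto
qed (auto simp: signed_weight_def)

section \<open>The maximal weight\<close>

text \<open>By \<open>weight_snoc\<close> the weight is the sum, over all nonempty prefixes, of
  their numbers of vertical links; in a position a prefix of length \<open>k\<close> has at most
  \<open>k - k div Suc m\<close> of them.\<close>

fun maxw :: "nat \<Rightarrow> nat \<Rightarrow> nat" where
  "maxw m 0 = 0"
| "maxw m (Suc n) = maxw m n + (Suc n - Suc n div Suc m)"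

text \<open>Thus \<open>z_num m n\<close> is the sum of \<open>k div Suc m\<close> over
  \<open>k \<le> n\<close>. The cases are whether the remainder wraps from \<open>m\<close> to
  0.\<close>

lemma z_num_Suc: "z_num m (Suc n) = z_num m n + Suc n div Suc m"
proof (cases "Suc n mod Suc m = 0")
  case True
  then have "Suc (n mod Suc m) = Suc m" by (metis mod_Suc nat.distinct(1))
  then have *: "n mod Suc m = m" by (rule Suc_inject)
  have "Suc k choose 2 = k + (k choose 2)" for k by (simp add: numeral_2_eq_2)
  with True * show ?thesis
    by (simp add: z_num_def Let_def div_Suc algebra_simps)
next
  case False
  then have "Suc n mod Suc m = Suc (n mod Suc m)" by (metis mod_Suc)
  with False show ?thesis by (simp add: z_num_def Let_def div_Suc algebra_simps)
qed

lemma maxw_eq: "maxw m n + z_num m n = s_num n"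
proof (induction n)
  case 0
  then show ?case by (simp add: z_num_def s_num_def numeral_2_eq_2)
next
  case (Suc n)
  have "Suc n div Suc m \<le> Suc n" by (rule div_le_dividend)
  moreover have "s_num (Suc n) = s_num n + Suc n"
    by (simp add: s_num_def numeral_2_eq_2)
  ultimately show ?case using Suc unfolding z_num_Suc maxw.simps by linarith
qed

lemma z_num_add_period: "z_num m (n + Suc m) = z_num m n + Suc n"
proof (induction n)
  case 0
  then show ?case by (simp add: z_num_def Let_def numeral_2_eq_2)
next
  case (Suc n)
  have "Suc (n + Suc m) div Suc m = Suc (Suc n div Suc m)"
    using div_add_self2[of "Suc m" "Suc n"] by simp
  with Suc show ?case by (simp add: z_num_Suc)
qed

lemma maxw_mono: "n \<le> n' \<Longrightarrow> maxw m n \<le> maxw m n'"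
proof (induction n' rule: dec_induct)
  case (step n')
  have "maxw m n' \<le> maxw m (Suc n')" unfolding maxw.simps by (rule le_add1)
  with step show ?case by linarith
qed auto

lemma maxw_step2: "maxw m q \<le> maxw m (q - 2) + 2 * q"
proof -
  have step: "maxw m k \<le> maxw m (k - 1) + k" for k by (cases k) auto
  have "maxw m q \<le> maxw m (q - 1) + q" by (rule step)
  also have "maxw m (q - 1) \<le> maxw m (q - 2) + (q - 1)" using step[of "q - 1"] by (simp add: numeral_2_eq_2)
  finally show ?thesis by simp
qed

text \<open>The step to length \<open>k\<close> adds \<open>k - k div Suc m\<close>, which is at
  least 2 for \<open>k \<ge> 3\<close> as \<open>m \<ge> 2\<close>.\<close>

lemma maxw_growth:
  assumes "m \<ge> 2" "2 \<le> c" "c \<le> n"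
  shows "maxw m c + 2 * (n - c) \<le> maxw m n"
  using assms(3)
proof (induction n rule: dec_induct)
  case (step n)
  have "Suc n div Suc m \<le> Suc n div 3" using assms(1) by (intro div_le_mono2) auto
  also have "Suc n div 3 \<le> Suc n - 2" using step(1) assms(2) by presburger
  finally have "Suc n - Suc n div Suc m \<ge> 2" using step(1) assms(2) by linarith
  then show ?case using step by simp
qed auto

section \<open>How many vertical links a position can have\<close>

lemma strip_vertical_run:
  assumes "no_reversal b" "R \<notin> set b" "strip m h b"
  shows "length b \<le> m"
proof -
  have "\<exists>l. l \<noteq> R \<and> b = replicate (length b) l"
    using assms(1,2)
  proof (induction b)
    case Nil
    then show ?case by (intro exI[of _ U]) auto
  next
    case (Cons x b)
    then obtain l where "l \<noteq> R" "b = replicate (length b) l"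
      by (cases b) (auto simp: no_reversal_def)
    with Cons.prems show ?case
      by (cases b; cases x; cases l) (auto simp: no_reversal_def)
  qed
  then obtain l where l: "l \<noteq> R" "b = replicate (length b) l" by blast
  have "0 \<le> h" "h \<le> int m" using assms(3) strip_bounds by blast+
  moreover have "strip m (h + int (length b) * rise l) []"
    using assms(3) l(2) strip_append[of m h b "[]"] by (metis append_Nil2 sum_list_rise_replicate)
  ultimately show ?thesis using l(1) by (cases l) auto
qed

text \<open>Each full block of \<open>Suc m\<close> links contains an \<open>R\<close>, because a
  vertical run has at most \<open>m\<close> links; blocks are cut off from the front.\<close>

lemma verticals_le:
  assumes "no_reversal w" "strip m h w"
  shows "verticals w \<le> length w - length w div Suc m"
  using assms
proof (induction w arbitrary: h rule: length_induct)
  case (1 w)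
  show ?case
  proof (cases "length w < Suc m")
    case False
    define b v where "b = take (Suc m) w" "v = drop (Suc m) w"
    have w: "w = b @ v" "length b = Suc m" using False by (auto simp: b_v_def)
    have "no_reversal b" "no_reversal v" using "1.prems"(1) w(1) no_reversal_append by blast+
    moreover have b: "strip m h b" and "strip m (h + sum_list (map rise b)) v"
      using "1.prems"(2) w(1) strip_append by blast+
    ultimately have IH: "verticals v \<le> length v - length v div Suc m"
      using "1.IH" w by (metis add_less_cancel_right add_0 length_append zero_less_Suc)
    have "R \<in> set b" using strip_vertical_run[OF \<open>no_reversal b\<close> _ b] w(2) by fastforce
    then have "verticals b < length b" by (intro length_filter_less[of R]) auto
    moreover have "length w div Suc m = Suc (length v div Suc m)"
      using w div_add_self1[of "Suc m" "length v"] by simp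
    moreover have "length v div Suc m \<le> length v" by (rule div_le_dividend)
    moreover have "verticals w = verticals b + verticals v" "length w = Suc m + length v"
      using w by auto
    ultimately show ?thesis using IH w(2) by linarith
  qed simp
qed

lemma weight_le_maxw:
  assumes "no_reversal w" "strip m h w"
  shows "weight w \<le> maxw m (length w)"
  using assms
proof (induction w rule: rev_induct)
  case (snoc l w)
  then have "weight w \<le> maxw m (length w)" by (simp add: no_reversal_append strip_append)
  with verticals_le[OF snoc.prems] show ?case
    unfolding weight_snoc maxw.simps length_append_singleton by (rule add_mono[rotated])
qed auto


section \<open>Walks\<close>

lemma slide:
  assumes "a \<noteq> R"
    and "xs @ replicate k R @ a # ys \<in> positions m n"
    and "xs @ a # replicate k R @ ys \<in> positions m n"
  shows "(xs @ replicate k R @ a # ys, xs @ a # replicate k R @ ys) \<in> arcs_of m n ^^ k"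
  using assms(2,3)
proof (induction k arbitrary: xs)
  case (Suc k)
  \<comment> \<open>The word before the last swap. Its heights are those of the target; for
    \<open>k = 0\<close> the link \<open>a\<close> meets \<open>ys\<close> as it does at the
    start.\<close>
  let ?v = "xs @ R # a # replicate k R @ ys"
  have "no_reversal (a # replicate k R @ ys)"
    using Suc.prems(1)
    by (cases k) (auto simp: in_positions_iff no_reversal_append dest: no_reversal_ConsD)
  then have v: "?v \<in> positions m n"
    using Suc.prems by (auto simp: in_positions_iff strip_append no_reversal_append)
  then have "(xs @ replicate (Suc k) R @ a # ys, ?v) \<in> arcs_of m n ^^ k"
    using Suc.IH[of "xs @ [R]"] Suc.prems(1) by simp
  moreover have "(?v, xs @ a # replicate (Suc k) R @ ys) \<in> arcs_of m n"
    using v Suc.prems(2) raise_prefix[OF swap[OF assms(1)], of xs] by (simp add: arcs_of_iff)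
  ultimately show ?case by auto
qed auto

lemma clear_single:
  assumes "a \<noteq> R" and "xs @ a # replicate k R \<in> positions m n"
  shows "(xs @ a # replicate k R, xs @ replicate (Suc k) R) \<in> arcs_of m n ^^ Suc k"
proof -
  let ?v = "xs @ replicate k R @ [a]"
  have v: "?v \<in> positions m n" and w: "xs @ replicate (Suc k) R \<in> positions m n"
    using assms(2) by (cases k; auto simp: in_positions_iff strip_append no_reversal_append)+
  have "(xs @ a # replicate k R, ?v) \<in> arcs_of m n ^^ k"
    using slide[OF assms(1) v] assms(2) by (simp add: arcs_relpow_sym)
  moreover have "(?v, xs @ replicate (Suc k) R) \<in> arcs_of m n"
    using v w raise_prefix[OF flip[OF assms(1)], of "xs @ replicate k R"]
    by (simp add: arcs_of_iff replicate_append_same)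
  ultimately show ?thesis by auto
qed

text \<open>The tail is cleared first, so each vertical link has only horizontal ones behind it when
  it slides to the end and is flipped, in as many moves as it contributes to the weight.\<close>

lemma clear:
  assumes "xs @ ys \<in> positions m n"
  shows "(xs @ ys, xs @ replicate (length ys) R) \<in> arcs_of m n ^^ weight ys
       \<and> xs @ replicate (length ys) R \<in> positions m n"
  using assms
proof (induction ys arbitrary: xs)
  case (Cons l ys)
  from Cons.IH[of "xs @ [l]"] Cons.prems
  have 1: "(xs @ l # ys, xs @ l # replicate (length ys) R) \<in> arcs_of m n ^^ weight ys"
    and 2: "xs @ l # replicate (length ys) R \<in> positions m n" by auto
  show ?case
  proof (cases "l = R")
    case False
    have "(xs @ l # ys, xs @ replicate (Suc (length ys)) R)
        \<in> arcs_of m n ^^ (weight ys + Suc (length ys))"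
      using relpow_trans[OF 1 clear_single[OF False 2]] .
    moreover have "xs @ replicate (Suc (length ys)) R \<in> positions m n"
      using 2 by (auto simp: in_positions_iff strip_append no_reversal_append)
    ultimately show ?thesis using False by (simp add: add.commute)
  qed (use 1 2 in simp)
qed auto

text \<open>Clear both words behind the link \<open>a\<close>; what remains differs by a slide of
  \<open>a\<close>.\<close>

lemma walk_same_vertical:
  assumes "a \<noteq> R" "i \<le> i'"
    and v: "xs @ replicate i R @ a # v \<in> positions m n"
    and w: "xs @ replicate i' R @ a # w \<in> positions m n"
  shows "(xs @ replicate i R @ a # v, xs @ replicate i' R @ a # w)
       \<in> arcs_of m n ^^ (weight v + (i' - i) + weight w)"
proof -
  define k where "k = i' - i"
  have i': "i' = i + k" using assms(2) by (simp add: k_def)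
  have len: "length v = k + length w" using v w by (simp add: in_positions_iff i')
  let ?xs = "xs @ replicate i R"
  let ?v = "?xs @ a # replicate k R @ replicate (length w) R"
  let ?w = "?xs @ replicate k R @ a # replicate (length w) R"
  have 1: "(xs @ replicate i R @ a # v, ?v) \<in> arcs_of m n ^^ weight v"
    and "?v \<in> positions m n"
    using clear[of "xs @ replicate i R @ [a]" v] v by (simp_all add: len replicate_add)
  moreover have 2: "(?w, xs @ replicate i' R @ a # w) \<in> arcs_of m n ^^ weight w"
    and "?w \<in> positions m n"
    using clear[of "xs @ replicate i' R @ [a]" w] w
    by (simp_all add: i' replicate_add arcs_relpow_sym)
  ultimately have "(?v, ?w) \<in> arcs_of m n ^^ k"
    using slide[OF assms(1), of ?xs k "replicate (length w) R"] arcs_relpow_sym by blast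
  from relpow_trans[OF relpow_trans[OF 1 this] 2] show ?thesis by (simp add: k_def)
qed

text \<open>Sliding \<open>a\<close> forward in the second word gives both words the prefix up to
  \<open>a\<close>, so \<open>walk_same_vertical\<close> applies to \<open>e\<close>. As the total
  lengths agree, \<open>e\<close> slides by the difference of the lengths behind it.\<close>

lemma walk_same_two_verticals:
  assumes "a \<noteq> R" "e \<noteq> R" "i \<le> i'"
    and v: "replicate i R @ a # replicate j R @ e # v \<in> positions m n"
    and w: "replicate i' R @ a # replicate j' R @ e # w \<in> positions m n"
  shows "(replicate i R @ a # replicate j R @ e # v, replicate i' R @ a # replicate j' R @ e # w)
       \<in> arcs_of m n ^^ (weight v + weight w + (i' - i)
            + (length v - length w) + (length w - length v))"
proof -
  define k where "k = i' - i"
  have i': "i' = i + k" using assms(3) by (simp add: k_def)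
  have len: "j + length v = k + j' + length w" using v w by (simp add: in_positions_iff i')
  let ?ys = "replicate j' R @ e # w"
  let ?w = "replicate i R @ a # replicate k R @ ?ys"
  have wd: "replicate i' R @ a # ?ys = replicate i R @ replicate k R @ a # ?ys"
    by (simp add: i' replicate_add)
  have "no_reversal (a # replicate k R @ ?ys)"
    using w by (cases k) (auto simp: in_positions_iff dest: no_reversal_ConsD)
  then have w': "?w \<in> positions m n"
    using w by (auto simp: in_positions_iff i')
  then have 1: "(?w, replicate i' R @ a # ?ys) \<in> arcs_of m n ^^ k"
    using slide[OF assms(1), of "replicate i R" k ?ys] w unfolding wd by (blast intro: arcs_relpow_sym)
  let ?xs = "replicate i R @ [a]"
  have w'': "?xs @ replicate (k + j') R @ e # w \<in> positions m n" using w' by (simp add: replicate_add)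
  have v': "?xs @ replicate j R @ e # v \<in> positions m n" using v by simp
  have "(?xs @ replicate j R @ e # v, ?xs @ replicate (k + j') R @ e # w)
      \<in> arcs_of m n ^^ (weight v + weight w + (length v - length w) + (length w - length v))"
  proof (cases "j \<le> k + j'")
    case True
    have "weight v + (k + j' - j) + weight w
        = weight v + weight w + (length v - length w) + (length w - length v)"
      using len True by linarith
    with walk_same_vertical[OF assms(2) True v' w''] show ?thesis by simp
  next
    case False
    then have le: "k + j' \<le> j" by simp
    have "weight w + (j - (k + j')) + weight v
        = weight v + weight w + (length v - length w) + (length w - length v)"
      using len le by linarith
    with arcs_relpow_sym[OF walk_same_vertical[OF assms(2) le w'' v']] show ?thesis by simp
  qed
  then have 2: "(replicate i R @ a # replicate j R @ e # v, ?w)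
      \<in> arcs_of m n ^^ (weight v + weight w + (length v - length w) + (length w - length v))"
    by (simp add: replicate_add)
  from relpow_trans[OF 2 1] show ?thesis by (simp add: k_def add_ac)
qed

section \<open>The upper bound for the diameter\<close>

lemma word_cases:
  obtains "w = replicate (length w) R"
  | i a w' where "a \<noteq> R" "w = replicate i R @ a # w'"
proof (induction w arbitrary: thesis)
  case (Cons l w)
  show ?case
  proof (cases "l = R")
    case True
    then show ?thesis
      using Cons.IH[of thesis] Cons.prems(1) Cons.prems(2)[of _ "Suc _"]
      by (metis append_Cons length_Cons replicate_Suc)
  qed (use Cons.prems(2)[of l 0 w] in simp)
qed auto

text \<open>At height 0 the first vertical link can only go up.\<close>

lemma position_cases:
  assumes "w \<in> positions m n"
  obtains "w = replicate n R"
  | i k where "w = replicate i R @ U # replicate k R"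
  | i j e w' where "e \<noteq> R" "w = replicate i R @ U # replicate j R @ e # w'"
proof (cases w rule: word_cases)
  case 1
  with assms that(1) show ?thesis by (simp add: in_positions_iff)
next
  case (2 i a w')
  have "strip m 0 (a # w')" using assms 2 by (simp add: in_positions_iff)
  with \<open>a \<noteq> R\<close> have a: "a = U" by (cases a) (auto dest: strip_bounds)
  show ?thesis
  proof (cases w' rule: word_cases)
    case 1
    with a 2 that(2) show ?thesis by metis
  next
    case (2 j e w'')
    with a \<open>w = _\<close> that(3) show ?thesis by metis
  qed
qed

lemma weight_suffix_le:
  assumes "xs @ ys \<in> positions m n"
  shows "weight ys \<le> maxw m (length ys)"
  using assms weight_le_maxw by (auto simp: in_positions_iff no_reversal_append strip_append)

text \<open>Pulling the first vertical link to the very front keeps the word legal, and there it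
  contributes \<open>n\<close>.\<close>

lemma weight_le_front:
  assumes "replicate i R @ U # v \<in> positions m n"
  shows "weight v + n \<le> maxw m n"
proof -
  have "no_reversal (U # replicate i R @ v)"
    using assms
    by (cases i) (auto simp: in_positions_iff no_reversal_append dest: no_reversal_ConsD)
  then have "weight (U # replicate i R @ v) \<le> maxw m (length (U # replicate i R @ v))"
    using assms by (intro weight_le_maxw[of _ m 0]) (auto simp: in_positions_iff)
  then show ?thesis using assms by (auto simp: in_positions_iff weight_append)
qed

lemma walk_horizontal:
  assumes "w \<in> positions m n"
  shows "(w, replicate n R) \<in> arcs_of m n ^^ weight w"
  using clear[of "[]" w] assms by (simp add: in_positions_iff)

text \<open>The truncated subtraction of 2 is a positive part; \<open>n - 4\<close> may be truncated since \<open>maxw m 0 = 0\<close>.\<close>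

definition close :: "nat \<Rightarrow> nat \<Rightarrow> link list \<Rightarrow> link list \<Rightarrow> bool" where
  "close m n v w \<longleftrightarrow> (\<exists>k \<le> maxw m n + (maxw m (n - 4) - 2). (v, w) \<in> arcs_of m n ^^ k)"

lemma close_sym: "close m n v w \<Longrightarrow> close m n w v"
  unfolding close_def using arcs_relpow_sym by blast

text \<open>Nothing is rebuilt behind the single vertical link, and the slide costs at most
  \<open>n\<close>, which \<open>weight_le_front\<close> leaves free.\<close>

lemma close_one_vertical:
  assumes v: "replicate i R @ U # v \<in> positions m n"
    and w: "replicate i' R @ U # replicate k R \<in> positions m n"
  shows "close m n (replicate i R @ U # v) (replicate i' R @ U # replicate k R)"
proof -
  have "\<exists>d \<le> weight v + n. (replicate i R @ U # v, replicate i' R @ U # replicate k R)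
      \<in> arcs_of m n ^^ d"
  proof (cases "i \<le> i'")
    case True
    then have "weight v + (i' - i) + 0 \<le> weight v + n" using w by (auto simp: in_positions_iff)
    with walk_same_vertical[OF _ True, of U "[]" v m n "replicate k R"] v w show ?thesis
      by (metis append_Nil link.distinct(3) weight_replicate_R)
  next
    case False
    then have le: "i' \<le> i" by simp
    have "0 + (i - i') + weight v \<le> weight v + n" using v by (auto simp: in_positions_iff)
    with walk_same_vertical[OF _ le, of U "[]" "replicate k R" m n v] v w show ?thesis
      by (metis append_Nil link.distinct(3) weight_replicate_R arcs_relpow_sym)
  qed
  with weight_le_front[OF v] show ?thesis unfolding close_def by (meson le_add1 le_trans)
qed

text \<open>By \<open>weight_le_front\<close>, \<open>weight v\<close> stays
  \<open>n + length v + 1\<close> below \<open>maxw m n\<close>. This pays for both slides and for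
  the excess \<open>2 * length w\<close> of \<open>weight w\<close> over
  \<open>maxw m (n - 4)\<close>, with the required 2 to spare.\<close>

lemma close_same_two_verticals:
  assumes "e \<noteq> R"
    and v: "replicate i R @ U # replicate j R @ e # v \<in> positions m n"
    and w: "replicate i' R @ U # replicate j' R @ e # w \<in> positions m n"
    and len: "length w \<le> length v"
  shows "close m n (replicate i R @ U # replicate j R @ e # v)
                   (replicate i' R @ U # replicate j' R @ e # w)"
    (is "close m n ?v ?w")
proof -
  have n: "n = i + j + length v + 2" "n = i' + j' + length w + 2"
    using v w by (auto simp: in_positions_iff)
  let ?d = "weight v + weight w + (length v - length w) + ((i' - i) + (i - i'))"
  have walk: "(?v, ?w) \<in> arcs_of m n ^^ ?d"
  proof (cases "i \<le> i'")
    case True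
    from walk_same_two_verticals[OF _ assms(1) True v w] len True show ?thesis
      by (simp add: add_ac)
  next
    case False
    then have le: "i' \<le> i" by simp
    from arcs_relpow_sym[OF walk_same_two_verticals[OF _ assms(1) le w v]] len le show ?thesis
      by (simp add: add_ac)
  qed
  have "weight (replicate j R @ e # v) + n \<le> maxw m n" by (rule weight_le_front[OF v])
  then have "weight v + length v + 1 + n \<le> maxw m n" using assms(1) by (simp add: weight_append)
  moreover have "weight w \<le> maxw m (length w)"
    by (rule weight_suffix_le[of "replicate i' R @ U # replicate j' R @ [e]" _ m n]) (use w in simp)
  moreover have "maxw m (length w) \<le> maxw m (length w - 2) + 2 * length w" by (rule maxw_step2)
  moreover have "maxw m (length w - 2) \<le> maxw m (n - 4)" using n by (intro maxw_mono) simp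
  ultimately have "?d \<le> maxw m n + (maxw m (n - 4) - 2)" using n len by linarith
  with walk show ?thesis unfolding close_def by blast
qed

text \<open>Only the first vertical link can be kept. The saving comes from the horizontal links
  that the second position needs before \<open>D\<close> and, if it continues, after it.\<close>

lemma close_opposite:
  assumes m: "m \<ge> 2"
    and v: "replicate i R @ U # replicate j R @ U # v \<in> positions m n"
    and w: "replicate i' R @ U # replicate j' R @ D # w \<in> positions m n"
  shows "close m n (replicate i R @ U # replicate j R @ U # v)
                   (replicate i' R @ U # replicate j' R @ D # w)"
    (is "close m n (replicate i R @ U # ?v) (replicate i' R @ U # ?w)")
proof -
  have n: "n = i + j + length v + 2" "n = i' + j' + length w + 2"
    using v w by (auto simp: in_positions_iff)
  have "j' \<noteq> 0"
  proof
    assume "j' = 0"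
    with w have "no_reversal (U # D # w)" by (simp add: in_positions_iff)
    then show False by (simp add: no_reversal_def)
  qed
  have w_suffix: "(replicate i' R @ U # replicate j' R @ [D, hd w]) @ tl w \<in> positions m n" if "w \<noteq> []"
    using w that by simp
  have "weight w \<le> maxw m (length w - 1)"
  proof (cases w)
    case (Cons l w')
    \<comment> \<open>after U and D the arm is back at height 0, so it has to turn right\<close>
    have "no_reversal ((replicate i' R @ U # replicate j' R) @ D # l # w')"
      using w Cons by (simp add: in_positions_iff)
    then have "no_reversal (D # l # w')" unfolding no_reversal_append by blast
    then have "l = R"
      using w Cons strip_bounds[of m "-1" w']
      by (cases l) (auto simp: in_positions_iff no_reversal_def)
    with Cons weight_suffix_le[OF w_suffix] show ?thesis by simp
  qed simp
  \<comment> \<open>The four links are \<open>U\<close>, \<open>D\<close>, one \<open>R\<close>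
    between them and the \<open>R\<close> after \<open>D\<close>.\<close>
  also have "\<dots> \<le> maxw m (n - 4)" using n \<open>j' \<noteq> 0\<close> by (intro maxw_mono) simp
  finally have ww: "weight ?w + i' + 2 \<le> n + maxw m (n - 4)"
    using n \<open>j' \<noteq> 0\<close> by (simp add: weight_append)
  show ?thesis
  proof (cases "i \<le> i'")
    case True
    have "weight ?v + n \<le> maxw m n" by (rule weight_le_front[OF v])
    then have "weight ?v + (i' - i) + weight ?w \<le> maxw m n + (maxw m (n - 4) - 2)"
      using ww True by linarith
    with walk_same_vertical[OF _ True, of U "[]"] v w show ?thesis
      unfolding close_def by (metis append_Nil link.distinct(3))
  next
    case False
    then have le: "i' \<le> i" by simp
    have "weight (U # ?v) \<le> maxw m (length (U # ?v))"
      by (rule weight_suffix_le[OF v])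
    moreover have "length (U # ?v) = n - i" using n by simp
    \<comment> \<open>Starting \<open>i\<close> links late loses \<open>2 * i\<close> of the maximal
      weight: half of it makes up for the first link weighing only \<open>n - i\<close>, the other
      half pays for the slide.\<close>
    moreover have "maxw m (n - i) + 2 * (n - (n - i)) \<le> maxw m n"
      using n m by (intro maxw_growth) auto
    ultimately have "weight ?v + n + i \<le> maxw m n" using n by simp
    then have "weight ?w + (i - i') + weight ?v \<le> maxw m n + (maxw m (n - 4) - 2)"
      using ww le by linarith
    with walk_same_vertical[OF _ le, of U "[]"] v w show ?thesis
      unfolding close_def by (metis append_Nil link.distinct(3) arcs_relpow_sym)
  qed
qed

lemma positions_close:
  assumes "m \<ge> 2" and v: "v \<in> positions m n" and w: "w \<in> positions m n"
  shows "close m n v w"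
proof -
  have horizontal: "close m n u (replicate n R)" if "u \<in> positions m n" for u
  proof -
    have "weight u \<le> maxw m n"
      using weight_suffix_le[of "[]" u] that by (simp add: in_positions_iff)
    then have "weight u \<le> maxw m n + (maxw m (n - 4) - 2)" by simp
    with walk_horizontal[OF that] show ?thesis unfolding close_def by blast
  qed
  have two: "close m n v w"
    if v: "v \<in> positions m n" "e \<noteq> R" "v = replicate i R @ U # replicate j R @ e # v'"
      and w: "w \<in> positions m n" "e' \<noteq> R" "w = replicate i' R @ U # replicate j' R @ e' # w'"
    for v w e e' i j i' j' v' w'
  proof (cases "e = e'")
    case True
    then show ?thesis
      using close_same_two_verticals[of e i j v' m n i' j' w']
        close_same_two_verticals[of e i' j' w' m n i j v'] that close_sym
      by (metis nat_le_linear)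
  next
    case False
    then have "e = U \<and> e' = D \<or> e = D \<and> e' = U"
      using that by (cases e; cases e') auto
    then show ?thesis using close_opposite[OF assms(1)] that close_sym by metis
  qed
  from v show ?thesis
  proof (cases rule: position_cases)
    case 1
    with horizontal[OF w] close_sym show ?thesis by blast
  next
    case v: (2 i k)
    from w show ?thesis
      by (cases rule: position_cases)
         (use v assms horizontal close_one_vertical close_sym in metis)+
  next
    case v: (3 i j e v')
    from w show ?thesis
      by (cases rule: position_cases)
         (use v assms horizontal close_one_vertical two close_sym in metis)+
  qed
qed


section \<open>The left justified positions\<close>

lemma snth_cycle: "xs \<noteq> [] \<Longrightarrow> cycle xs !! i = xs ! (i mod length xs)"
  by (metis hd_rotate_conv_nth sdrop_cycle sdrop_simps(1) cycle.simps(1) mod_mod_trivial rotate_is_Nil_conv)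

lemma snth_snake:
  assumes "r = i mod Suc (Suc (2 * m))"
  shows "snake m !! i = (if r < m then U else if r = m then R else if r \<le> 2 * m then D else R)"
proof -
  let ?xs = "replicate m U @ [R] @ replicate m D @ [R]"
  have "length ?xs = Suc (Suc (2 * m))" by simp
  then have "snake m !! i = ?xs ! r"
    unfolding snake_def assms using snth_cycle[of ?xs i] by (simp add: mult_2)
  moreover have "r < Suc (Suc (2 * m))" unfolding assms by (rule mod_less_divisor) simp
  ultimately show ?thesis by (auto simp: nth_append nth_Cons')
qed

text \<open>The period consists of two halves of \<open>Suc m\<close> links, each ending in
  \<open>R\<close>; indices start at 0, hence \<open>Suc i\<close>.\<close>

lemma snth_snake_eq_R_iff: "snake m !! i = R \<longleftrightarrow> Suc i mod Suc m = 0"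
proof -
  define r where "r = i mod Suc (Suc (2 * m))"
  have r: "r < Suc (Suc (2 * m))" unfolding r_def by (rule mod_less_divisor) simp
  have "Suc (Suc (2 * m)) = Suc m * 2" by simp
  then have "i mod Suc m = r mod Suc m" unfolding r_def
    by (metis dvd_triv_left mod_mod_cancel)
  also have "\<dots> = (if r < Suc m then r else r - Suc m)"
    using r by (simp add: le_mod_geq)
  finally have "i mod Suc m = m \<longleftrightarrow> r = m \<or> r = Suc (2 * m)"
    using r by auto
  moreover have "snake m !! i = R \<longleftrightarrow> r = m \<or> r = Suc (2 * m)"
    using r by (auto simp: snth_snake[OF r_def])
  ultimately show ?thesis by (auto simp: mod_Suc)
qed

text \<open>The height climbs through the first half of the period and falls through the second; the
  \<open>R\<close> ending each half repeats the extreme heights \<open>m\<close> and 0.\<close>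

lemma rise_stake_snake:
  "r = n mod Suc (Suc (2 * m)) \<Longrightarrow>
   sum_list (map rise (stake n (snake m))) = (if r \<le> m then int r else 2 * int m + 1 - int r)"
proof (induction n arbitrary: r)
  case (Suc n)
  define q where "q = n mod Suc (Suc (2 * m))"
  have "q < Suc (Suc (2 * m))" unfolding q_def by (rule mod_less_divisor) simp
  moreover have "r = (if q = Suc (2 * m) then 0 else Suc q)"
    unfolding Suc.prems q_def by (simp add: mod_Suc)
  ultimately show ?case
    by (auto simp: stake_Suc Suc.IH[OF q_def] snth_snake[OF q_def] simp del: stake.simps)
qed simp

lemma left_justified_Suc:
  "left_justified m (Suc n) = left_justified m n @ [snake m !! n]"
  by (simp add: left_justified_def stake_Suc del: stake.simps)

lemma length_left_justified [simp]: "length (left_justified m n) = n"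
  by (simp add: left_justified_def)

lemma left_justified_in_positions: "left_justified m n \<in> positions m n"
proof (induction n)
  case 0
  then show ?case by (simp add: left_justified_def in_positions_iff)
next
  case (Suc n)
  define q where "q = n mod Suc (Suc (2 * m))"
  have "q < Suc (Suc (2 * m))" unfolding q_def by (rule mod_less_divisor) simp
  then have "strip m (sum_list (map rise (left_justified m n))) [snake m !! n]"
    by (auto simp: left_justified_def rise_stake_snake[OF q_def] snth_snake[OF q_def])
  moreover have "no_reversal (left_justified m (Suc n))"
  proof (cases n)
    case (Suc k)
    have "no_reversal [snake m !! k, snake m !! Suc k]"
      by (auto simp: no_reversal_def snth_snake[OF refl] mod_Suc simp del: snth.simps)
    with Suc.IH Suc show ?thesis
      by (simp add: left_justified_Suc no_reversal_append in_positions_iff)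
  qed (simp add: left_justified_def)
  ultimately show ?case
    using Suc.IH by (simp add: in_positions_iff left_justified_Suc strip_append)
qed

lemma verticals_left_justified: "verticals (left_justified m n) + n div Suc m = n"
proof (induction n)
  case (Suc n)
  then show ?case
    by (simp add: left_justified_Suc div_Suc snth_snake_eq_R_iff)
qed (simp add: left_justified_def)

text \<open>All prefixes attain the bound of \<open>verticals_le\<close> simultaneously.\<close>

lemma weight_left_justified: "weight (left_justified m n) = maxw m n"
proof (induction n)
  case (Suc n)
  have "verticals (left_justified m (Suc n)) = Suc n - Suc n div Suc m"
    using verticals_left_justified[of m "Suc n"] by linarith
  with Suc show ?case
    unfolding left_justified_Suc weight_snoc maxw.simps by simp
qed (simp add: left_justified_def)

text \<open>As \<open>m \<ge> 2\<close>, the second link goes up as well, which makes the signed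
  weight of \<open>w\<close> positive unless \<open>w\<close> is empty.\<close>

lemma left_justified_decomp:
  assumes "m \<ge> 2" "n \<ge> 1"
  obtains w where "left_justified m n = U # w" "weight w + n = maxw m n" "w = [] \<or> lead w = U"
proof -
  obtain k where n: "n = Suc k" using assms(2) by (cases n) auto
  let ?w = "stake k (stl (snake m))"
  have "shd (snake m) = U" using snth_snake[of 0 0 m] assms(1) by simp
  then have L: "left_justified m n = U # ?w" by (simp add: left_justified_def n)
  moreover have "weight ?w + n = maxw m n"
    using weight_left_justified[of m n] L by (simp add: n)
  moreover have "shd (stl (snake m)) = U" using snth_snake[of 1 1 m] assms(1) by simp
  then have "?w = [] \<or> lead ?w = U" by (cases k) auto
  ultimately show thesis using that by blast
qed

section \<open>The shifted left justified position\<close>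

lemma shifted_left_justified_eq:
  "shifted_left_justified m n = take n [U, R, D, R] @ left_justified m (n - 4)"
  by (simp add: shifted_left_justified_def left_justified_def stake_shift numeral_eq_Suc del: shift.simps)

text \<open>The \<open>D\<close> in third place contributes \<open>n - 2\<close>, the left justified
  rest \<open>maxw m (n - 4)\<close>. For \<open>n < 4\<close> the prefix is cut short and truncated
  subtraction keeps the formula right.\<close>

lemma shifted_left_justified_decomp:
  assumes "m \<ge> 2" "n \<ge> 1"
  obtains w where "shifted_left_justified m n = U # w" "weight w = (n - 2) + maxw m (n - 4)"
    "w = [] \<or> w = [R] \<or> lead w = D" "U # w \<in> positions m n"
proof -
  consider "n = 1" | "n = 2" | "n = 3" | "n \<ge> 4" using assms(2) by linarith
  then show thesis
  proof cases
    case 4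
    have "left_justified m (n - 4) \<in> positions m (n - 4)" by (rule left_justified_in_positions)
    then have "[U, R, D, R] @ left_justified m (n - 4) \<in> positions m n"
      using 4 assms(1) by (auto simp: in_positions_iff)
    with 4 show thesis
      by (intro that[of "[R, D, R] @ left_justified m (n - 4)"])
         (auto simp: shifted_left_justified_eq weight_left_justified)
  qed (use assms(1) in \<open>auto intro!: that simp: shifted_left_justified_eq left_justified_def
         in_positions_iff numeral_eq_Suc\<close>)
qed

text \<open>For \<open>n \<ge> 4\<close> the index \<open>m + n - 3\<close> is one period
  \<open>Suc m\<close> beyond \<open>n - 4\<close>; for smaller \<open>n\<close> it is at most
  \<open>m\<close>, where \<open>z_num\<close> vanishes.\<close>

lemma maxw_shifted:
  assumes "n \<ge> 1"
  shows "maxw m (n - 4) + (n - 2) + z_num m (m + n - 3) = s_num (n - 2)"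
proof (cases "n \<ge> 4")
  case True
  then obtain p where n: "n = p + 4" using le_Suc_ex by (metis add.commute)
  have *: "s_num (Suc k) = s_num k + Suc k" for k by (simp add: s_num_def numeral_2_eq_2)
  have "s_num (p + 2) = s_num p + (p + 1) + (p + 2)" using *[of p] *[of "Suc p"] by simp
  moreover have "z_num m (m + n - 3) = z_num m p + Suc p"
    using z_num_add_period[of m p] by (simp add: n add.commute)
  ultimately show ?thesis using maxw_eq[of m p] by (simp add: n)
next
  case False
  with assms consider "n = 1" | "n = 2" | "n = 3" by linarith
  then show ?thesis by cases (simp_all add: z_num_def s_num_def numeral_2_eq_2)
qed

section \<open>The distances\<close>

lemma dist_le:
  assumes "(v, w) \<in> arcs_of m n ^^ k" "v \<in> positions m n"
  shows "graph_dist (transition_graph m n) v w \<le> ereal (real k)"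
  using pair_wf_digraph.relpow_imp_graph_dist_le[OF pair_wf_transition_graph] assms by simp

lemma dist_horizontal:
  assumes "w \<in> positions m n"
  shows "graph_dist (transition_graph m n) w (horizontal n) = ereal (real (weight w))"
proof (rule antisym)
  have "\<bar>int (weight v) - int (weight w)\<bar> \<le> 1" if "(v, w) \<in> arcs_of m n" for v w
    using that raise_weight by (auto simp: arcs_of_iff)
  from pair_wf_digraph.lipschitz_le_graph_dist[where f = "\<lambda>v. int (weight v)"
      and u = w and v = "replicate n R", OF pair_wf_transition_graph this]
  show "ereal (real (weight w)) \<le> graph_dist (transition_graph m n) w (horizontal n)"
    by (simp add: horizontal_def)
qed (use dist_le[OF walk_horizontal] assms in \<open>simp add: horizontal_def\<close>)

lemma dist_left_justified_shifted:
  assumes "m \<ge> 2" "n \<ge> 1"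
  shows "graph_dist (transition_graph m n) (left_justified m n) (shifted_left_justified m n)
       = ereal (real (maxw m n - n + (n - 2) + maxw m (n - 4)))"
proof -
  obtain v where v: "left_justified m n = U # v" "weight v + n = maxw m n" "v = [] \<or> lead v = U"
    using left_justified_decomp[OF assms] .
  obtain w where w: "shifted_left_justified m n = U # w" "weight w = (n - 2) + maxw m (n - 4)"
    "w = [] \<or> w = [R] \<or> lead w = D" "U # w \<in> positions m n"
    using shifted_left_justified_decomp[OF assms] .
  have V: "U # v \<in> positions m n" using left_justified_in_positions[of m n] v(1) by simp
  have sum: "maxw m n - n + (n - 2) + maxw m (n - 4) = weight v + weight w" using v(2) w(2) by simp
  have "(U # v, U # w) \<in> arcs_of m n ^^ (weight v + weight w)"
    using walk_same_vertical[of U 0 0 "[]" v m n w] V w(4) by simp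
  then have "graph_dist (transition_graph m n) (U # v) (U # w) \<le> ereal (real (weight v + weight w))"
    using V by (rule dist_le)
  moreover
  \<comment> \<open>The signs are opposite, so the difference is the sum of the weights; the words
    \<open>[]\<close> and \<open>[R]\<close> have weight 0.\<close>
  have "signed_weight v = int (weight v)" "signed_weight w = - int (weight w)"
    using v(3) w(3) by (auto simp: signed_weight_def)
  moreover
  have "\<bar>signed_weight (after v) - signed_weight (after w)\<bar> \<le> 1" if "(v, w) \<in> arcs_of m n" for v w
    using that raise_signed_weight_after[of v w] raise_signed_weight_after[of w v]
    by (auto simp: arcs_of_iff abs_minus_commute)
  note pair_wf_digraph.lipschitz_le_graph_dist[where f = "\<lambda>v. signed_weight (after v)"
      and u = "U # v" and v = "U # w", OF pair_wf_transition_graph this]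
  ultimately show ?thesis unfolding v(1) w(1) sum by (intro antisym) auto
qed

theorem theorem1p7:
  fixes m n :: nat
  assumes "m \<ge> 2" and "n \<ge> 1"
  shows "graph_diameter (transition_graph m n) =
           (if n < 6
            then graph_dist (transition_graph m n) (left_justified m n) (horizontal n)
            else graph_dist (transition_graph m n) (left_justified m n) (shifted_left_justified m n))
       \<and> graph_dist (transition_graph m n) (left_justified m n) (horizontal n) =
           ereal (real (s_num n) - real (z_num m n))
       \<and> graph_dist (transition_graph m n) (left_justified m n) (shifted_left_justified m n) =
           ereal (real (s_num (n - 1)) - real (z_num m n) + real (s_num (n - 2)) - real (z_num m (m + n - 3)))"
proof (intro conjI)
  let ?G = "transition_graph m n" and ?L = "left_justified m n"
  let ?K = "maxw m n + (maxw m (n - 4) - 2)"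
  have horizontal: "graph_dist ?G ?L (horizontal n) = ereal (real (maxw m n))"
    using dist_horizontal[OF left_justified_in_positions] by (simp add: weight_left_justified)
  note shifted = dist_left_justified_shifted[OF assms]
  have L: "?L \<in> positions m n" by (rule left_justified_in_positions)
  have H: "horizontal n \<in> positions m n" by (simp add: horizontal_def in_positions_iff)
  have S: "shifted_left_justified m n \<in> positions m n"
    using shifted_left_justified_decomp[OF assms] by metis
  have n_le: "n \<le> maxw m n" using left_justified_decomp[OF assms] by (metis le_add2)
  show "graph_dist ?G ?L (horizontal n) = ereal (real (s_num n) - real (z_num m n))"
    unfolding horizontal maxw_eq[of m n, symmetric] by simp
  have "s_num n = s_num (n - 1) + n" using assms(2) by (cases n) (simp_all add: s_num_def numeral_2_eq_2)
  with n_le maxw_eq[of m n] maxw_shifted[OF assms(2), of m]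
  show "graph_dist ?G ?L (shifted_left_justified m n) =
      ereal (real (s_num (n - 1)) - real (z_num m n) + real (s_num (n - 2)) - real (z_num m (m + n - 3)))"
    unfolding shifted by (simp add: of_nat_diff)
  have "graph_dist ?G v w \<le> ereal (real ?K)" if v: "v \<in> positions m n" and w: "w \<in> positions m n" for v w
  proof -
    obtain k where "k \<le> ?K" "(v, w) \<in> arcs_of m n ^^ k"
      using positions_close[OF assms(1) v w] unfolding close_def by blast
    with dist_le[OF this(2) v] show ?thesis by (meson ereal_less_eq(3) of_nat_le_iff order_trans)
  qed
  then have le: "graph_diameter ?G \<le> ereal (real ?K)"
    unfolding graph_diameter_def by (auto intro!: SUP_least)
  have ge: "graph_dist ?G v w \<le> graph_diameter ?G" if "v \<in> positions m n" "w \<in> positions m n" for v w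
    unfolding graph_diameter_def using that by (auto intro!: SUP_upper2[of v] SUP_upper)
  show "graph_diameter ?G =
      (if n < 6 then graph_dist ?G ?L (horizontal n) else graph_dist ?G ?L (shifted_left_justified m n))"
  proof (cases "n < 6")
    case True
    \<comment> \<open>Here \<open>n - 4\<close> is at most 1, so the truncated summand of
      \<open>?K\<close> is 0.\<close>
    then have "maxw m (n - 4) \<le> maxw m 1" by (intro maxw_mono) simp
    also have "\<dots> \<le> 1" by simp
    finally have "?K = maxw m n" by simp
    with le ge[OF L H] horizontal True show ?thesis by (simp add: antisym)
  next
    case False
    \<comment> \<open>From \<open>n = 6\<close> on the subtraction of 2 in \<open>?K\<close> is
      exact, and it equals the \<open>- n + (n - 2)\<close> of the distance.\<close>
    have "2 \<le> maxw m 2" using assms(1) by (simp add: numeral_2_eq_2)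
    also have "\<dots> \<le> maxw m (n - 4)" using False by (intro maxw_mono) simp
    finally have "?K = maxw m n - n + (n - 2) + maxw m (n - 4)" using n_le False by linarith
    with le ge[OF L S] shifted False show ?thesis by (simp add: antisym)
  qed
qed

end
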